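(* Let $\gamma>0$. Then \[ \Psi_\gamma(\alpha)\le\Gamma_\gamma(\alpha)\qquad\text{for all }\alpha>0 , \] and equality holds at $\alpha$ if and only if $\alpha$ solves the equation $\varphi(x_\alpha,y^\delta)-\gamma\,\alpha\,\psi(x_\alpha)=0$.
   Context: Let $X,Y$ be Banach spaces, $Q_{\mathrm{ad}}\subset X$ a nonempty admissible set, $y^\delta\in Y$ fixed data, and let $\varphi(\cdot,y^\delta):Q_{\mathrm{ad}}\to[0,\infty)$ and $\psi:Q_{\mathrm{ad}}\to[0,\infty)$ be given. For $\alpha>0$ put $J_\alpha(x)=\varphi(x,y^\delta)+\alpha\psi(x)$ and $F(\alpha)=\inf_{x\in Q_{\mathrm{ad}}}J_\alpha(x)$. It is assumed that for every $\alpha>0$ the infimum is attained; $x_\alpha\in Q_{\mathrm{ad}}$ denotes a minimizer, so that $F(\alpha)=\varphi(x_\alpha,y^\delta)+\alpha\psi(x_\alpha)$. For $\gamma>0$ define \[ \Psi_\gamma(\alpha)=\varphi(x_\alpha,y^\delta)^\gamma\,\psi(x_\alpha),\qquad \Gamma_\gamma(\alpha)=\frac{\gamma^\gamma}{(1+\gamma)^{1+\gamma}}\,\frac{F(\alpha)^{1+\gamma}}{\alpha}. \] *)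

theory Defs
  imports "HOL-Analysis.Analysis"
begin

definition J_fun :: "('a \<Rightarrow> 'b \<Rightarrow> real) \<Rightarrow> ('a \<Rightarrow> real) \<Rightarrow> 'b \<Rightarrow> real \<Rightarrow> 'a \<Rightarrow> real" where
  "J_fun \<phi> \<psi> y \<alpha> x = \<phi> x y + \<alpha> * \<psi> x"

(* The infimum in the reals is meaningful when Q is nonempty and J is bounded below on Q,
   as is the case for nonnegative \<phi>, \<psi> and \<alpha>. *)
definition F_val ::
    "'a set \<Rightarrow> ('a \<Rightarrow> 'b \<Rightarrow> real) \<Rightarrow> ('a \<Rightarrow> real) \<Rightarrow> 'b \<Rightarrow> real \<Rightarrow> real" where
  "F_val Q \<phi> \<psi> y \<alpha> = (INF x\<in>Q. J_fun \<phi> \<psi> y \<alpha> x)"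

(* xm is the selection of minimizers: xm \<alpha> plays the role of x_\<alpha>.
   Real powers are powr, which agrees with the usual power on the nonnegative reals
   for positive exponents (0 powr c = 0). *)
definition Psi_fun ::
    "('a \<Rightarrow> 'b \<Rightarrow> real) \<Rightarrow> ('a \<Rightarrow> real) \<Rightarrow> 'b \<Rightarrow> (real \<Rightarrow> 'a) \<Rightarrow> real \<Rightarrow> real \<Rightarrow> real" where
  "Psi_fun \<phi> \<psi> y xm \<gamma> \<alpha> = \<phi> (xm \<alpha>) y powr \<gamma> * \<psi> (xm \<alpha>)"

definition Gamma_fun ::
    "'a set \<Rightarrow> ('a \<Rightarrow> 'b \<Rightarrow> real) \<Rightarrow> ('a \<Rightarrow> real) \<Rightarrow> 'b \<Rightarrow> real \<Rightarrow> real \<Rightarrow> real" where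
  "Gamma_fun Q \<phi> \<psi> y \<gamma> \<alpha> =
     \<gamma> powr \<gamma> / (1 + \<gamma>) powr (1 + \<gamma>) * (F_val Q \<phi> \<psi> y \<alpha> powr (1 + \<gamma>) / \<alpha>)"

end

theory Submission
  imports Defs
begin

text \<open>
  Since \<open>xm \<alpha>\<close> minimizes, \<open>F(\<alpha>) = p + b\<close> with \<open>p = \<phi>(xm \<alpha>, y)\<close> and \<open>b = \<alpha> \<psi>(xm \<alpha>)\<close>. Multiplying
  the claim by \<open>\<alpha>\<close> turns it into a statement about two nonnegative numbers: for a fixed sum
  \<open>p + b\<close>, the product \<open>p\<^sup>\<gamma> b\<close> is largest exactly when \<open>p\<close> and \<open>b\<close> are in the ratio \<open>\<gamma> : 1\<close>
  (\<open>powr_mult_le_sum_powr\<close>). This is the weighted arithmetic-geometric mean inequality with weights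
  \<open>\<gamma>/(1+\<gamma>)\<close> and \<open>1/(1+\<gamma>)\<close>. Its normalized form \<open>powr_mult_le_one\<close> follows from
  \<open>ln x \<le> x - 1\<close>, whose equality case \<open>x = 1\<close> also settles when equality holds.
\<close>

text \<open>
  The product has logarithm \<open>\<gamma> ln s + ln t \<le> \<gamma> (s - 1) + (t - 1) = 0\<close>. Both summands are bounded
  separately, so equality forces \<open>ln s = s - 1\<close>.
\<close>
lemma powr_mult_le_one:
  fixes s t \<gamma> :: real
  assumes "0 < s" "0 < t" "0 < \<gamma>" and mean: "\<gamma> * s + t = 1 + \<gamma>"
  shows "s powr \<gamma> * t \<le> 1" and "s powr \<gamma> * t = 1 \<longleftrightarrow> s = 1"
proof -
  have pos: "0 < s powr \<gamma> * t"
    using assms by simp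
  have ln_prod: "ln (s powr \<gamma> * t) = \<gamma> * ln s + ln t"
    using assms by (simp add: ln_mult ln_powr)
  have ln_s: "\<gamma> * ln s \<le> \<gamma> * (s - 1)"
    using assms ln_le_minus_one[of s] by simp
  have ln_t: "ln t \<le> t - 1"
    using assms ln_le_minus_one by simp
  have zero: "\<gamma> * (s - 1) + (t - 1) = 0"
    using mean by (simp add: algebra_simps)
  have "ln (s powr \<gamma> * t) \<le> 0"
    unfolding ln_prod using ln_s ln_t zero by linarith
  then show "s powr \<gamma> * t \<le> 1"
    using pos by simp
  show "s powr \<gamma> * t = 1 \<longleftrightarrow> s = 1"
  proof
    assume "s powr \<gamma> * t = 1"
    then have "\<gamma> * ln s + ln t = 0"
      using ln_prod by simp
    then have "\<gamma> * ln s = \<gamma> * (s - 1)"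
      using ln_s ln_t zero by linarith
    then have "ln s = s - 1"
      using \<open>0 < \<gamma>\<close> by simp
    then show "s = 1"
      using \<open>0 < s\<close> by (rule ln_eq_minus_one[rotated])
  next
    assume "s = 1"
    then show "s powr \<gamma> * t = 1"
      using mean by simp
  qed
qed

text \<open>
  Rescaling \<open>p\<close> and \<open>b\<close> by their optimal values \<open>\<gamma> (p + b)/(1+\<gamma>)\<close> and \<open>(p + b)/(1+\<gamma>)\<close> reduces
  this to the normalized inequality. On the boundary the left side vanishes, while the right side
  and \<open>p - \<gamma> b\<close> vanish only if both numbers do.
\<close>
lemma powr_mult_le_sum_powr:
  fixes p b \<gamma> :: real
  assumes "0 \<le> p" "0 \<le> b" and \<gamma>: "0 < \<gamma>"
  defines "C \<equiv> \<gamma> powr \<gamma> / (1 + \<gamma>) powr (1 + \<gamma>)"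
  shows "p powr \<gamma> * b \<le> C * (p + b) powr (1 + \<gamma>)"
    and "p powr \<gamma> * b = C * (p + b) powr (1 + \<gamma>) \<longleftrightarrow> p = \<gamma> * b"
proof -
  have C: "0 < C"
    using \<gamma> by (simp add: C_def)
  have "p powr \<gamma> * b \<le> C * (p + b) powr (1 + \<gamma>) \<and>
    (p powr \<gamma> * b = C * (p + b) powr (1 + \<gamma>) \<longleftrightarrow> p = \<gamma> * b)"
  proof (cases "p = 0 \<or> b = 0")
    case True
    then show ?thesis
      using assms(1,2) \<gamma> C by auto
  next
    case False
    then have p: "0 < p" and b: "0 < b"
      using assms(1,2) by auto
    define S where "S = p + b"
    define s where "s = p * (1 + \<gamma>) / (\<gamma> * S)"
    define t where "t = b * (1 + \<gamma>) / S"
    have S: "0 < S"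
      using p b by (simp add: S_def)
    have s: "0 < s" and t: "0 < t"
      using p b S \<gamma> by (simp_all add: s_def t_def)
    have "\<gamma> * s + t = (p + b) * (1 + \<gamma>) / S"
      using S \<gamma> by (simp add: s_def t_def add_divide_distrib distrib_right)
    then have mean: "\<gamma> * s + t = 1 + \<gamma>"
      using S by (simp add: S_def)
    have p_eq: "p = \<gamma> * S * s / (1 + \<gamma>)" and b_eq: "b = S * t / (1 + \<gamma>)"
      using S \<gamma> by (simp_all add: s_def t_def)
    define R where "R = C * S powr (1 + \<gamma>)"
    have R: "0 < R"
      using C S by (simp add: R_def)
    have "p powr \<gamma> * b = (\<gamma> * S * s / (1 + \<gamma>)) powr \<gamma> * (S * t / (1 + \<gamma>))"
      using p_eq b_eq by simp
    also have "\<dots> = R * (s powr \<gamma> * t)"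
      using S s \<gamma> by (simp add: R_def C_def powr_mult powr_divide powr_add mult_ac)
    finally have prod: "p powr \<gamma> * b = R * (s powr \<gamma> * t)" .
    have "s = 1 \<longleftrightarrow> p = \<gamma> * b"
    proof -
      have "s = 1 \<longleftrightarrow> p * (1 + \<gamma>) = \<gamma> * S"
        using S \<gamma> by (auto simp: s_def)
      then show ?thesis
        by (simp add: S_def distrib_left mult.commute)
    qed
    moreover have "R * (s powr \<gamma> * t) \<le> R"
      using powr_mult_le_one(1)[OF s t \<gamma> mean] R by simp
    moreover have "R * (s powr \<gamma> * t) = R \<longleftrightarrow> s = 1"
      using powr_mult_le_one(2)[OF s t \<gamma> mean] R by simp
    ultimately show ?thesis
      using prod by (simp add: R_def S_def)
  qed
  then show "p powr \<gamma> * b \<le> C * (p + b) powr (1 + \<gamma>)"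
    and "p powr \<gamma> * b = C * (p + b) powr (1 + \<gamma>) \<longleftrightarrow> p = \<gamma> * b"
    by auto
qed

lemma F_val_eq_J_fun_minimizer:
  assumes "is_arg_min (J_fun \<phi> \<psi> y \<alpha>) (\<lambda>x. x \<in> Q) x"
  shows "F_val Q \<phi> \<psi> y \<alpha> = J_fun \<phi> \<psi> y \<alpha> x"
  unfolding F_val_def
  using assms by (intro cInf_eq_minimum) (auto simp: is_arg_min_def not_less)

theorem proposition3:
  fixes Q :: "'a::banach set"
    and y :: "'b::banach"
    and \<phi> :: "'a \<Rightarrow> 'b \<Rightarrow> real"
    and \<psi> :: "'a \<Rightarrow> real"
    and xm :: "real \<Rightarrow> 'a"
    and \<gamma> :: real
  assumes "Q \<noteq> {}"
    and "\<And>x. x \<in> Q \<Longrightarrow> 0 \<le> \<phi> x y"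
    and "\<And>x. x \<in> Q \<Longrightarrow> 0 \<le> \<psi> x"
    and "\<And>\<alpha>. 0 < \<alpha> \<Longrightarrow> \<exists>x\<in>Q. J_fun \<phi> \<psi> y \<alpha> x = F_val Q \<phi> \<psi> y \<alpha>"
    and "\<And>\<alpha>. 0 < \<alpha> \<Longrightarrow> is_arg_min (J_fun \<phi> \<psi> y \<alpha>) (\<lambda>x. x \<in> Q) (xm \<alpha>)"
    and "0 < \<gamma>"
  shows "(\<forall>\<alpha>>0. Psi_fun \<phi> \<psi> y xm \<gamma> \<alpha> \<le> Gamma_fun Q \<phi> \<psi> y \<gamma> \<alpha>) \<and>
    (\<forall>\<alpha>>0. Psi_fun \<phi> \<psi> y xm \<gamma> \<alpha> = Gamma_fun Q \<phi> \<psi> y \<gamma> \<alpha> \<longleftrightarrow>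
       \<phi> (xm \<alpha>) y - \<gamma> * \<alpha> * \<psi> (xm \<alpha>) = 0)"
proof -
  have pointwise: "Psi_fun \<phi> \<psi> y xm \<gamma> \<alpha> \<le> Gamma_fun Q \<phi> \<psi> y \<gamma> \<alpha> \<and>
    (Psi_fun \<phi> \<psi> y xm \<gamma> \<alpha> = Gamma_fun Q \<phi> \<psi> y \<gamma> \<alpha> \<longleftrightarrow>
       \<phi> (xm \<alpha>) y - \<gamma> * \<alpha> * \<psi> (xm \<alpha>) = 0)"
    if \<alpha>: "0 < \<alpha>" for \<alpha>
  proof -
    define p where "p = \<phi> (xm \<alpha>) y"
    define b where "b = \<alpha> * \<psi> (xm \<alpha>)"
    define R where "R = \<gamma> powr \<gamma> / (1 + \<gamma>) powr (1 + \<gamma>) * (p + b) powr (1 + \<gamma>)"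
    have "xm \<alpha> \<in> Q"
      using assms(5)[OF \<alpha>] by (simp add: is_arg_min_def)
    then have p: "0 \<le> p" and b: "0 \<le> b"
      using assms(2,3) \<alpha> by (simp_all add: p_def b_def)
    have "F_val Q \<phi> \<psi> y \<alpha> = p + b"
      using F_val_eq_J_fun_minimizer[OF assms(5)[OF \<alpha>]] by (simp add: J_fun_def p_def b_def)
    then have Gamma: "Gamma_fun Q \<phi> \<psi> y \<gamma> \<alpha> = R / \<alpha>"
      by (simp add: Gamma_fun_def R_def)
    have Psi: "Psi_fun \<phi> \<psi> y xm \<gamma> \<alpha> = p powr \<gamma> * b / \<alpha>"
      using \<alpha> by (simp add: Psi_fun_def p_def b_def)
    have "p powr \<gamma> * b \<le> R" and "p powr \<gamma> * b = R \<longleftrightarrow> p = \<gamma> * b"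
      unfolding R_def using powr_mult_le_sum_powr[OF p b \<open>0 < \<gamma>\<close>] by simp_all
    moreover have "\<phi> (xm \<alpha>) y - \<gamma> * \<alpha> * \<psi> (xm \<alpha>) = 0 \<longleftrightarrow> p = \<gamma> * b"
      by (simp add: p_def b_def mult.assoc)
    ultimately show ?thesis
      unfolding Gamma Psi using \<alpha> by (simp add: divide_right_mono)
  qed
  then show ?thesis
    by blast
qed

end
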